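(* $\mathcal{P}\subseteq\mathcal{F}$. In particular, $\mathcal{F}$ includes the class of finite solvable groups.
   Context: A finite group $G$ is said to be factorized into subsets $A,B\subseteq G$, written $G=AB$, if every $g\in G$ can be uniquely represented as $g=xy$ with $x\in A$ and $y\in B$ (equivalently, $G=\{xy : x\in A, y\in B\}$ and $|G|=|A||B|$). $\mathcal{F}$ denotes the class of all finite groups $G$ such that for every factorization $|G|=ab$ of the order of $G$ into positive integers $a,b$ there is a factorization $G=AB$ into subsets with $|A|=a$ and $|B|=b$. $\mathcal{P}$ denotes the class of finite groups $G$ having a series of subgroups $1=G_0<G_1<\ldots<G_{t-1}<G_t=G$ (each $G_{i-1}$ being a subgroup, not necessarily normal, of $G_i$) such that the index $|G_i:G_{i-1}|$ is a prime for $i=1,2,\ldots,t$. *)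

theory Defs
  imports "HOL-Algebra.Solvable_Groups" "HOL-Computational_Algebra.Primes"
begin

definition factorized :: "('a, 'b) monoid_scheme \<Rightarrow> 'a set \<Rightarrow> 'a set \<Rightarrow> bool" where
  "factorized G A B \<longleftrightarrow>
     A \<subseteq> carrier G \<and> B \<subseteq> carrier G \<and>
     (\<forall>g\<in>carrier G. \<exists>!(x, y). x \<in> A \<and> y \<in> B \<and> g = x \<otimes>\<^bsub>G\<^esub> y)"

definition class_F :: "('a, 'b) monoid_scheme set" where
  "class_F = {G. group G \<and> finite (carrier G) \<and>
     (\<forall>a b. 0 < a \<longrightarrow> 0 < b \<longrightarrow> order G = a * b \<longrightarrow>
        (\<exists>A B. factorized G A B \<and> card A = a \<and> card B = b))}"

(* The length t may be 0, so the trivial group is included. *)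
definition prime_index_series :: "('a, 'b) monoid_scheme \<Rightarrow> (nat \<Rightarrow> 'a set) \<Rightarrow> nat \<Rightarrow> bool" where
  "prime_index_series G H t \<longleftrightarrow>
     H 0 = {\<one>\<^bsub>G\<^esub>} \<and> H t = carrier G \<and>
     (\<forall>i\<le>t. subgroup (H i) G) \<and>
     (\<forall>i\<in>{1..t}. H (i - 1) \<subset> H i \<and>
        prime (card (rcosets\<^bsub>G\<lparr>carrier := H i\<rparr>\<^esub> (H (i - 1)))))"

definition class_P :: "('a, 'b) monoid_scheme set" where
  "class_P = {G. group G \<and> finite (carrier G) \<and> (\<exists>H t. prime_index_series G H t)}"

end

theory Submission
  imports Defs "HOL-Algebra.Sylow"
begin

text \<open>
  Let \<open>H\<close> have prime index \<open>p\<close> in \<open>G\<close>, and let \<open>|G| = a b\<close>. Inverting a factorization swaps its factors,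
  so we may assume that \<open>p\<close> divides \<open>b\<close>. Given a factorization \<open>H = A B\<close> with \<open>|A| = a\<close>, \<open>|B| = b / p\<close>
  and a transversal \<open>T\<close> with \<open>G = H T\<close>, we get \<open>G = A (B T)\<close>, and \<open>|B T| = b\<close> by counting. Climbing a
  series with prime indices settles the first claim. For solvable groups the steps are refined:
  if \<open>N\<close> is a proper normal subgroup of \<open>G\<close> with abelian quotient, then the preimage of a subgroup of
  prime order of \<open>G/N\<close> is a group between \<open>N\<close> and \<open>G\<close> containing \<open>N\<close> with prime index.
\<close>

text \<open>A version of factorization for subsets, without uniqueness: for finite sets it follows
  from the cardinalities by counting. Only the multiplication of \<open>G\<close> enters, not its
  carrier, so the notion is the same in a subgroup as in the ambient group.\<close>

definition factorizable :: "('a, 'b) monoid_scheme \<Rightarrow> 'a set \<Rightarrow> bool" where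
  "factorizable G K \<longleftrightarrow> (\<forall>a b. card K = a * b \<longrightarrow>
     (\<exists>A B. A \<subseteq> K \<and> B \<subseteq> K \<and> A <#>\<^bsub>G\<^esub> B = K \<and> card A = a \<and> card B = b))"

lemma factorizable_consistent [simp]: "factorizable (G\<lparr>carrier := H\<rparr>) K = factorizable G K"
  by (simp add: factorizable_def)

lemma set_mult_eq_image: "A <#>\<^bsub>G\<^esub> B = (\<lambda>(x, y). x \<otimes>\<^bsub>G\<^esub> y) ` (A \<times> B)"
  by (auto simp: set_mult_def)

lemma card_set_mult_le:
  assumes "finite A" "finite B"
  shows "card (A <#>\<^bsub>G\<^esub> B) \<le> card A * card B"
  using card_image_le[of "A \<times> B"] assms by (simp add: set_mult_eq_image card_cartesian_product)

text \<open>Multiplication maps the finite set \<open>A \<times> B\<close> onto a set of the same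
  size, so it is injective, and this is the uniqueness required.\<close>

lemma factorizedI:
  assumes fin: "finite (carrier G)" and sub: "A \<subseteq> carrier G" "B \<subseteq> carrier G"
    and AB: "A <#>\<^bsub>G\<^esub> B = carrier G" and card: "order G = card A * card B"
  shows "factorized G A B"
proof -
  have "finite A" "finite B"
    using fin sub finite_subset by auto
  then have inj: "inj_on (\<lambda>(x, y). x \<otimes>\<^bsub>G\<^esub> y) (A \<times> B)"
    using AB card by (intro eq_card_imp_inj_on)
      (auto simp: set_mult_eq_image order_def card_cartesian_product)
  have "\<exists>!(x, y). x \<in> A \<and> y \<in> B \<and> g = x \<otimes>\<^bsub>G\<^esub> y" if "g \<in> carrier G" for g
  proof -
    have "g \<in> (\<lambda>(x, y). x \<otimes>\<^bsub>G\<^esub> y) ` (A \<times> B)"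
      using AB that by (simp add: set_mult_eq_image)
    then obtain x y where "x \<in> A" "y \<in> B" "g = x \<otimes>\<^bsub>G\<^esub> y" by auto
    then show ?thesis
      using inj by (intro ex1I[of _ "(x, y)"]) (auto simp: inj_on_def)
  qed
  then show ?thesis
    using sub by (auto simp: factorized_def)
qed

lemma class_F_I:
  assumes "group G" "finite (carrier G)" "factorizable G (carrier G)"
  shows "G \<in> class_F"
proof -
  have "\<exists>A B. factorized G A B \<and> card A = a \<and> card B = b" if ab: "order G = a * b" for a b
  proof -
    obtain A B where "A \<subseteq> carrier G" "B \<subseteq> carrier G" "A <#>\<^bsub>G\<^esub> B = carrier G"
      "card A = a" "card B = b"
      using assms(3) ab unfolding factorizable_def order_def by metis
    then show ?thesis
      using factorizedI[OF assms(2)] ab by blast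
  qed
  then show ?thesis
    using assms by (simp add: class_F_def)
qed

section \<open>Ascent from a subgroup of prime index\<close>

context group
begin

lemma factorizable_one: "factorizable G {\<one>}"
  by (auto simp: factorizable_def set_mult_def intro!: exI[of _ "{\<one>}"])

lemma m_inv_image_carrier: "m_inv G ` carrier G = carrier G"
  by (force simp: image_iff intro: bexI[of _ "inv _"])

lemma m_inv_image_set_mult:
  assumes "A \<subseteq> carrier G" "B \<subseteq> carrier G"
  shows "m_inv G ` (A <#> B) = m_inv G ` B <#> m_inv G ` A"
proof -
  have "inv (x \<otimes> y) = inv y \<otimes> inv x" if "x \<in> A" "y \<in> B" for x y
    using that assms by (intro inv_mult_group) auto
  then show ?thesis
    by (force simp: set_mult_def)
qed

lemma card_m_inv_image:
  assumes "A \<subseteq> carrier G"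
  shows "card (m_inv G ` A) = card A"
  using assms by (intro card_image inj_on_subset[OF inv_inj])

text \<open>One representative is chosen from each right coset. An upper bound on
  \<open>card T\<close> is enough for the counting argument that follows.\<close>

lemma right_transversal:
  assumes "subgroup H G" "finite (carrier G)"
  obtains T where "T \<subseteq> carrier G" "H <#> T = carrier G" "card T \<le> card (rcosets H)"
proof -
  define f where "f = (\<lambda>R. SOME t. t \<in> carrier G \<and> R = H #> t)"
  have f: "f R \<in> carrier G \<and> R = H #> f R" if "R \<in> rcosets H" for R
    unfolding f_def by (rule someI_ex) (use that in \<open>auto simp: RCOSETS_def\<close>)
  let ?T = "f ` (rcosets H)"
  have "H <#> ?T = (\<Union>R\<in>rcosets H. H #> f R)"
    by (auto simp: set_mult_def r_coset_def)
  also have "\<dots> = \<Union>(rcosets H)"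
    using f by (metis (no_types, lifting) SUP_cong UN_singleton image_ident)
  finally have "H <#> ?T = carrier G"
    by (simp add: rcosets_part_G assms)
  moreover have "finite (rcosets H)"
    using assms rcosets_part_G finite_UnionD by metis
  ultimately show ?thesis
    using that[of ?T] f card_image_le by blast
qed

lemma factorizable_prime_index:
  assumes fin: "finite (carrier G)" and H: "subgroup H G"
    and p: "prime (card (rcosets H))" and fact: "factorizable G H"
  shows "factorizable G (carrier G)"
proof -
  let ?p = "card (rcosets H)"
  have sub: "H \<subseteq> carrier G"
    using H by (rule subgroup.subset)
  have dvd_right: "\<exists>A B. A \<subseteq> carrier G \<and> B \<subseteq> carrier G \<and> A <#> B = carrier G \<and> card A = a \<and> card B = b"
    if ab: "card (carrier G) = a * b" and "?p dvd b" for a b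
  proof -
    obtain c where b: "b = ?p * c" using \<open>?p dvd b\<close> by auto
    \<comment> \<open>The order of \<open>G\<close> is positive; this allows cancelling
      \<open>a\<close> in the final count.\<close>
    have pos: "a > 0"
      using ab fin by (metis card_gt_0_iff empty_iff mult_is_0 neq0_conv one_closed)
    have "?p * card H = ?p * (a * c)"
      using lagrange[OF H] ab b by (metis mult.left_commute order_def)
    then have "card H = a * c"
      using p by (metis mult_cancel1 not_prime_0)
    then obtain A B where AB: "A \<subseteq> H" "B \<subseteq> H" "A <#> B = H" "card A = a" "card B = c"
      using fact unfolding factorizable_def by metis
    obtain T where T: "T \<subseteq> carrier G" "H <#> T = carrier G" "card T \<le> ?p"
      using right_transversal[OF H fin] .
    have BT: "B <#> T \<subseteq> carrier G"
      using AB sub T by (intro setmult_subset_G) auto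
    have finite: "finite A" "finite B" "finite T" "finite (B <#> T)"
      using AB sub T BT fin by (meson finite_subset subset_trans)+
    have eq: "A <#> (B <#> T) = carrier G"
      using AB sub T set_mult_assoc[of A B T] by auto
    have "card (B <#> T) \<le> c * card T"
      using card_set_mult_le[of B T G] finite AB by simp
    also have "\<dots> \<le> c * ?p"
      using T by simp
    finally have "card (B <#> T) \<le> b"
      by (simp add: b mult.commute)
    \<comment> \<open>The reverse bound: the products of \<open>A\<close> and \<open>B <#> T\<close>
      cover all \<open>a * b\<close> elements of \<open>G\<close>.\<close>
    moreover have "a * b \<le> a * card (B <#> T)"
      using card_set_mult_le[of A "B <#> T" G] finite AB eq ab by simp
    ultimately have "card (B <#> T) = b"
      using pos by simp
    then show ?thesis
      using AB sub BT eq by blast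
  qed
  show ?thesis
    unfolding factorizable_def
  proof (intro allI impI)
    fix a b assume ab: "card (carrier G) = a * b"
    then have "?p dvd a * b"
      using lagrange[OF H] by (metis dvd_triv_left order_def)
    then consider "?p dvd b" | "?p dvd a"
      using p prime_dvd_multD by blast
    then show "\<exists>A B. A \<subseteq> carrier G \<and> B \<subseteq> carrier G \<and> A <#> B = carrier G \<and> card A = a \<and> card B = b"
    proof cases
      case 1
      then show ?thesis using dvd_right ab by blast
    next
      case 2
      \<comment> \<open>The previous case with \<open>a\<close> and \<open>b\<close> exchanged;
        inversion then restores the order of the factors.\<close>
      then obtain A B where AB: "A \<subseteq> carrier G" "B \<subseteq> carrier G" "A <#> B = carrier G"
        "card A = b" "card B = a"
        using dvd_right[of b a] ab by (auto simp: mult.commute)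
      then have "m_inv G ` B <#> m_inv G ` A = carrier G"
        using m_inv_image_set_mult[of A B] m_inv_image_carrier by simp
      moreover have "m_inv G ` A \<subseteq> carrier G" "m_inv G ` B \<subseteq> carrier G"
        using AB by auto
      ultimately show ?thesis
        using AB card_m_inv_image by metis
    qed
  qed
qed

text \<open>The preceding result is applied to \<open>L\<close> as a group of its own, and
  \<open>factorizable_consistent\<close> carries the conclusion back to \<open>G\<close>.\<close>

lemma factorizable_prime_index_subgroup:
  assumes "finite (carrier G)" "subgroup K G" "subgroup L G" "K \<subseteq> L"
    and "prime (card (rcosets\<^bsub>G\<lparr>carrier := L\<rparr>\<^esub> K))" and "factorizable G K"
  shows "factorizable G L"
proof -
  have "finite L"
    using assms by (meson finite_subset subgroup.subset)
  then show ?thesis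
    using group.factorizable_prime_index[OF subgroup_imp_group[OF assms(3)], of K]
      subgroup_incl[OF assms(2-4)] assms(5,6) by simp
qed

section \<open>Groups with a series of prime indices\<close>

lemma prime_index_series_imp_factorizable:
  assumes fin: "finite (carrier G)" and series: "prime_index_series G H t"
  shows "factorizable G (carrier G)"
proof -
  have "factorizable G (H i)" if "i \<le> t" for i
    using that
  proof (induction i)
    case 0
    then show ?case
      using series factorizable_one by (simp add: prime_index_series_def)
  next
    case (Suc i)
    have "subgroup (H i) G" "subgroup (H (Suc i)) G"
      using series Suc.prems by (auto simp: prime_index_series_def)
    moreover have "H i \<subset> H (Suc i) \<and> prime (card (rcosets\<^bsub>G\<lparr>carrier := H (Suc i)\<rparr>\<^esub> (H i)))"
      using series Suc.prems unfolding prime_index_series_def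
      by (metis Suc_le_mono atLeastAtMost_iff diff_Suc_1 le0 One_nat_def)
    ultimately show ?case
      using Suc factorizable_prime_index_subgroup[OF fin, of "H i" "H (Suc i)"] by auto
  qed
  then show ?thesis
    using series by (metis order_refl prime_index_series_def)
qed

section \<open>Abelian quotients and solvable groups\<close>

lemma derived_le_imp_normal:
  assumes K: "subgroup K G" and le: "derived G (carrier G) \<subseteq> K"
  shows "K \<lhd> G" and "comm_group (G Mod K)"
proof -
  interpret K: subgroup K G by fact
  \<comment> \<open>Both claims rest on commutators lying in \<open>K\<close>: a conjugate of
    \<open>h\<close> is a commutator times \<open>h\<close>, and \<open>x \<otimes> y\<close> is a
    commutator times \<open>y \<otimes> x\<close>.\<close>
  have comm: "x \<otimes> y \<otimes> inv x \<otimes> inv y \<in> K" if "x \<in> carrier G" "y \<in> carrier G" for x y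
  proof -
    have "x \<otimes> y \<otimes> inv x \<otimes> inv y \<in> derived_set G (carrier G)"
      using that by blast
    then show ?thesis
      using le unfolding derived_def by (meson generate.incl subsetD)
  qed
  show "K \<lhd> G"
  proof (rule normal_invI[OF K])
    fix x h assume *: "x \<in> carrier G" "h \<in> K"
    then have "x \<otimes> h \<otimes> inv x = (x \<otimes> h \<otimes> inv x \<otimes> inv h) \<otimes> h"
      by (simp add: m_assoc)
    also have "\<dots> \<in> K"
      using * comm[of x h] K.mem_carrier K.m_closed by blast
    finally show "x \<otimes> h \<otimes> inv x \<in> K" .
  qed
  then interpret N: normal K G .
  show "comm_group (G Mod K)"
  proof (rule group.group_comm_groupI[OF N.factorgroup_is_group])
    fix X Y assume "X \<in> carrier (G Mod K)" "Y \<in> carrier (G Mod K)"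
    then obtain x y where xy: "x \<in> carrier G" "y \<in> carrier G" "X = K #> x" "Y = K #> y"
      by (auto simp: carrier_FactGroup)
    have "(x \<otimes> y \<otimes> inv x \<otimes> inv y) \<otimes> (y \<otimes> x) = x \<otimes> y \<otimes> (inv (y \<otimes> x) \<otimes> (y \<otimes> x))"
      using xy by (simp add: inv_mult_group m_assoc del: l_inv)
    also have "\<dots> = x \<otimes> y"
      using xy by simp
    finally have "x \<otimes> y \<in> K #> (y \<otimes> x)"
      using comm[of x y] xy unfolding r_coset_def by force
    then have "K #> (x \<otimes> y) = K #> (y \<otimes> x)"
      using repr_independence K xy by (metis m_closed)
    then show "X \<otimes>\<^bsub>G Mod K\<^esub> Y = Y \<otimes>\<^bsub>G Mod K\<^esub> X"
      using xy by (simp add: N.rcos_sum)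
  qed
qed

text \<open>Induction on the number of elements outside \<open>N\<close>. The quotient condition is
  phrased through the derived subgroup because this form passes at once to every subgroup containing
  \<open>N\<close>.\<close>

lemma factorizable_abelian_quotient:
  assumes fin: "finite (carrier G)" and "subgroup N G" "derived G (carrier G) \<subseteq> N"
    and "factorizable G N"
  shows "factorizable G (carrier G)"
  using assms(2-)
proof (induction "card (carrier G) - card N" arbitrary: N rule: less_induct)
  case less
  show ?case
  proof (cases "N = carrier G")
    case True
    then show ?thesis using less.prems by simp
  next
    case False
    interpret N: normal N G
      using derived_le_imp_normal less.prems by blast
    let ?Q = "G Mod N"
    interpret Q: comm_group ?Q
      using derived_le_imp_normal less.prems by blast
    have finQ: "finite (carrier ?Q)"
      using fin by (simp add: carrier_FactGroup)
    have "order ?Q \<noteq> 1"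
      using False N.fact_group_trivial_iff[OF fin] Q.order_one_triv_iff by simp
    then obtain p where p: "prime p" "p dvd order ?Q"
      using prime_factor_nat by blast
    then obtain m where "order ?Q = p ^ 1 * m" by auto
    \<comment> \<open>Sylow's theorem with exponent 1 serves as Cauchy's theorem; \<open>m\<close>
      may still be divisible by \<open>p\<close>.\<close>
    then obtain S where S: "subgroup S ?Q" "card S = p ^ 1"
      using sylow_thm[OF p(1) Q.is_group _ finQ] by blast
    have L: "subgroup (\<Union>S) G"
      by (rule N.factgroup_subgroup_union_subgroup[OF S(1)])
    have NS: "N \<in> S"
      using subgroup.one_closed[OF S(1)] by simp
    \<comment> \<open>\<open>S\<close> is a set of cosets of \<open>N\<close>, and
      \<open>\<Union>S\<close> is its preimage in \<open>G\<close>, so the index of \<open>N\<close>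
      in \<open>\<Union>S\<close> is \<open>card S = p\<close>.\<close>
    have idx: "rcosets\<^bsub>G\<lparr>carrier := \<Union>S\<rparr>\<^esub> N = S"
      using N.factgroup_subgroup_union_factor[OF S(1)] by simp
    have fact: "factorizable G (\<Union>S)"
      using factorizable_prime_index_subgroup[OF fin less.prems(1) L] NS less.prems(3) S p(1)
      by (auto simp: idx)
    \<comment> \<open>A second coset in \<open>S\<close>, disjoint from \<open>N\<close> and
      nonempty, makes \<open>\<Union>S\<close> strictly larger than \<open>N\<close>, so the
      induction measure drops.\<close>
    have "\<not> S \<subseteq> {N}"
      using S(2) p(1) card_mono[of "{N}" S] prime_gt_1_nat[of p] by auto
    then obtain R where R: "R \<in> S" "R \<noteq> N" by blast
    then have "R \<in> rcosets N"
      using subgroup.subset[OF S(1)] by (auto simp: FactGroup_def)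
    moreover have "N \<in> rcosets N"
      by (simp add: N.subgroup_in_rcosets)
    ultimately have "R \<inter> N = {}" "R \<noteq> {}"
      using R rcos_disjoint[OF less.prems(1)] N.rcosets_non_empty
      by (auto simp: pairwise_def disjnt_def)
    then have "N \<subset> \<Union>S"
      using R NS by blast
    then have "card N < card (\<Union>S)" "card (\<Union>S) \<le> card (carrier G)"
      using L fin by (meson finite_subset psubset_card_mono card_mono subgroup.subset)+
    then show ?thesis
      using less.hyps[of "\<Union>S"] L fact less.prems(2) NS by force
  qed
qed

text \<open>Each extension step has an abelian quotient, so by minimality the derived subgroup of
  \<open>H\<close> lies in \<open>K\<close>, and the previous lemma applies inside
  \<open>H\<close>.\<close>

lemma solvable_seq_imp_factorizable:
  assumes fin: "finite (carrier G)" and "solvable_seq G H"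
  shows "factorizable G H"
  using assms(2)
proof induction
  case unity
  show ?case by (rule factorizable_one)
next
  case (extension K H)
  interpret H: group "G\<lparr>carrier := H\<rparr>"
    using extension.hyps by (simp add: subgroup_imp_group)
  have "finite H"
    using fin extension.hyps by (meson finite_subset subgroup.subset)
  moreover have "derived (G\<lparr>carrier := H\<rparr>) (carrier (G\<lparr>carrier := H\<rparr>)) \<subseteq> K"
    using H.derived_minimal extension.hyps by blast
  ultimately show ?case
    using H.factorizable_abelian_quotient[of K] extension normal_imp_subgroup by auto
qed

end

theorem proposition2:
  shows "(class_P :: ('a, 'b) monoid_scheme set) \<subseteq> class_F
    \<and> {G :: ('a, 'b) monoid_scheme. group G \<and> finite (carrier G) \<and> solvable G} \<subseteq> class_F"
proof (intro conjI subsetI)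
  fix G :: "('a, 'b) monoid_scheme"
  assume "G \<in> class_P"
  then show "G \<in> class_F"
    by (auto simp: class_P_def intro!: class_F_I intro: group.prime_index_series_imp_factorizable)
next
  fix G :: "('a, 'b) monoid_scheme"
  assume "G \<in> {G. group G \<and> finite (carrier G) \<and> solvable G}"
  then show "G \<in> class_F"
    by (auto simp: solvable_def intro!: class_F_I intro: group.solvable_seq_imp_factorizable)
qed

end
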